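(* The time complexity of the divide-and-conquer forward algorithm described in the context, run on an input $\mathbf{e} = (e_1,\dots,e_n)$ with $e_i > 0$ for all $i$ and an integer $k \geq 1$, is $\mathcal{O}(kn)$; that is, there is an absolute constant $C$ such that for all integers $n, k \geq 1$ and all inputs $\mathbf{e} \in (0,\infty)^n$ the algorithm performs at most $C\,k\,n$ arithmetic operations.
   Context: For $\mathbf{e} \in \mathbb{R}^n$ and $1 \le i \le n$, $\sigma_i(\mathbf{e}) = \sum_{1 \le j_1 < \dots < j_i \le n} e_{j_1}\cdots e_{j_i}$ is the $i$-th elementary symmetric polynomial, and $\sigma_0(\mathbf{e}) = 1$. The algorithm takes $\mathbf{e} \in (0,\infty)^n$ and an integer $k \ge 1$ and works as follows. Polynomials in $X$ are encoded by their lists of coefficients, and only the coefficients of $X^0, \dots, X^k$ (those that exist, given the degree) are ever computed and kept. (1) Initialize $n$ polynomials $P_i = X + \frac{1}{e_i}$, $1 \le i \le n$. (2) While the current list contains $p > 1$ polynomials $P_1,\dots,P_p$: replace the list by the products $P_1 P_2,\ P_3 P_4,\ \dots$ of consecutive disjoint pairs, each product being truncated to degree at most $k$ (if $p$ is odd, the unpaired last polynomial is carried over unchanged). Each truncated product is computed by direct (schoolbook) convolution of the truncated coefficient lists (no fast Fourier transform). (3) When one polynomial is left, multiply all of its kept coefficients by $\prod_{i=1}^n e_i$ and return them. The returned coefficient of $X^i$ (for $0 \le i \le \min\{k,n\}$) is $\sigma_n(\mathbf{e})\,\sigma_{n-i}(1/e_1,\dots,1/e_n) = \sigma_i(\mathbf{e})$,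 so the algorithm evaluates $\sigma_0(\mathbf{e}),\dots,\sigma_k(\mathbf{e})$. Time complexity counts arithmetic operations (additions, multiplications, divisions) on real numbers, each at unit cost. *)

theory Defs
  imports Complex_Main "HOL-Library.State_Monad"
begin

text \<open>
  Computations on reals that count the arithmetic operations they perform: the state is the number
  of operations performed so far. Reals are combined only through the four operations below, each
  of unit cost; handling of lists and of (natural number) indices and degrees is free.
\<close>

type_synonym 'a counted = "(nat, 'a) state"

definition op_add :: "real \<Rightarrow> real \<Rightarrow> real counted" where
  "op_add x y = do { State_Monad.update Suc; State_Monad.return (x + y) }"

definition op_mult :: "real \<Rightarrow> real \<Rightarrow> real counted" where
  "op_mult x y = do { State_Monad.update Suc; State_Monad.return (x * y) }"

definition op_divide :: "real \<Rightarrow> real \<Rightarrow> real counted" where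
  "op_divide x y = do { State_Monad.update Suc; State_Monad.return (x / y) }"

definition arith_ops :: "'a counted \<Rightarrow> nat" where
  "arith_ops m = snd (run_state m 0)"

fun sum_counted :: "real list \<Rightarrow> real counted" where
  "sum_counted [] = State_Monad.return 0"
| "sum_counted [x] = State_Monad.return x"
| "sum_counted (x # y # xs) = do { s \<leftarrow> op_add x y; sum_counted (s # xs) }"

fun prod_counted :: "real list \<Rightarrow> real counted" where
  "prod_counted [] = State_Monad.return 1"
| "prod_counted [x] = State_Monad.return x"
| "prod_counted (x # y # xs) = do { s \<leftarrow> op_mult x y; prod_counted (s # xs) }"

text \<open>
  A polynomial is the list of its kept coefficients, constant coefficient first. The coefficient of
  $X^m$ in a product is the sum of all products of kept coefficients of $X^i$ and $X^{m-i}$;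
  leading coefficients equal to 1 are not treated specially.
\<close>

definition conv_coeff :: "real list \<Rightarrow> real list \<Rightarrow> nat \<Rightarrow> real counted" where
  "conv_coeff p q m = do {
     ts \<leftarrow> traverse_list (\<lambda>i. op_mult (p ! i) (q ! (m - i)))
            (filter (\<lambda>i. i < length p \<and> m - i < length q) [0..<Suc m]);
     sum_counted ts
   }"

definition trunc_mult :: "nat \<Rightarrow> real list \<Rightarrow> real list \<Rightarrow> real list counted" where
  "trunc_mult k p q =
     traverse_list (conv_coeff p q) [0..<min (Suc k) (length p + length q - 1)]"

fun merge_pairs :: "nat \<Rightarrow> real list list \<Rightarrow> real list list counted" where
  "merge_pairs k (p # q # ps) = do {
     r \<leftarrow> trunc_mult k p q;
     rs \<leftarrow> merge_pairs k ps;
     State_Monad.return (r # rs)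
   }"
| "merge_pairs k ps = State_Monad.return ps"

lemma length_merge_pairs:
  "run_state (merge_pairs k ps) s = (rs, s') \<Longrightarrow> length rs = (length ps + 1) div 2"
  by (induction k ps arbitrary: s rs s' rule: merge_pairs.induct) (auto split: prod.splits)

lemma bind_state_cong [fundef_cong]:
  assumes "m = m'"
    and "\<And>x s s'. run_state m' s = (x, s') \<Longrightarrow> f x = f' x"
  shows "State_Monad.bind m f = State_Monad.bind m' f'"
  using assms by (auto intro!: state_ext split: prod.splits)

function merge_all :: "nat \<Rightarrow> real list list \<Rightarrow> real list list counted" where
  "merge_all k ps =
     (if length ps > 1 then do { rs \<leftarrow> merge_pairs k ps; merge_all k rs }
      else State_Monad.return ps)"
  by auto
termination
  by (relation "measure (length \<circ> snd)") (auto dest: length_merge_pairs)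

declare merge_all.simps [simp del]

text \<open>
  The list starts with the coefficients of the polynomials $1/e_i + X$, which already have degree at
  most $k$ as $k \geq 1$.
\<close>

definition forward_alg :: "nat \<Rightarrow> real list \<Rightarrow> real list counted" where
  "forward_alg k es = do {
     ps \<leftarrow> traverse_list (\<lambda>e. do { c \<leftarrow> op_divide 1 e; State_Monad.return [c, 1] }) es;
     rs \<leftarrow> merge_all k ps;
     d \<leftarrow> prod_counted es;
     traverse_list (op_mult d) (hd rs)
   }"

end

theory Submission
  imports Defs
begin

text \<open>
  A polynomial which is the product of \<open>t\<close> of the initial ones keeps \<open>min k t + 1\<close> coefficients.
  With the potential \<open>\<Phi>(t) = m\<^sup>2 + 4k(t - m)\<close>, where \<open>m = min k t\<close>, one has
  \<open>\<Phi>(a + b) - \<Phi>(a) - \<Phi>(b) \<ge> 2 min(k,a) min(k,b)\<close>, whereas merging polynomials of true degrees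
  \<open>a, b \<ge> 1\<close> costs at most \<open>2 (min(k,a) + 1) (min(k,b) + 1) \<le> 8 min(k,a) min(k,b)\<close> operations.
  So every merge is paid for by four times the increase of the total potential, which is at most
  \<open>\<Phi>(n) \<le> 4kn\<close> in the end, however the polynomials are paired.
\<close>

section \<open>Upper bounds on operation counts\<close>

text \<open>A Hoare-style triple: the postcondition passes on the lengths of lists, on which the
  cost of later steps depends. Bounds are integers so that differences of potentials can be written
  without truncated subtraction.\<close>

definition costs :: "'a counted \<Rightarrow> int \<Rightarrow> ('a \<Rightarrow> bool) \<Rightarrow> bool" where
  "costs m c P \<longleftrightarrow>
     (\<forall>s x s'. run_state m s = (x, s') \<longrightarrow> int s' \<le> int s + c \<and> P x)"

lemma costs_mono:
  "costs m c P \<Longrightarrow> c \<le> d \<Longrightarrow> (\<And>x. P x \<Longrightarrow> Q x) \<Longrightarrow> costs m d Q"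
  unfolding costs_def by (meson add_left_mono order_trans)

lemma costs_return: "P x \<Longrightarrow> costs (State_Monad.return x) 0 P"
  by (simp add: costs_def State_Monad.return_def)

lemma costs_bind:
  assumes "costs m c P" and "\<And>x. P x \<Longrightarrow> costs (f x) d Q"
  shows "costs (State_Monad.bind m f) (c + d) Q"
  using assms unfolding costs_def
  by (fastforce split: prod.splits)

lemma arith_ops_le: "costs m c P \<Longrightarrow> int (arith_ops m) \<le> c"
  unfolding costs_def arith_ops_def by (metis add_0 of_nat_0 prod.collapse)

lemma costs_op:
  "costs (op_add x y) 1 (\<lambda>_. True)"
  "costs (op_mult x y) 1 (\<lambda>_. True)"
  "costs (op_divide x y) 1 (\<lambda>_. True)"
  by (auto simp: costs_def op_add_def op_mult_def op_divide_def State_Monad.update_def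
      State_Monad.return_def State_Monad.get_def State_Monad.set_def)

lemma costs_traverse_list:
  assumes "\<And>x. x \<in> set xs \<Longrightarrow> costs (f x) (c x) P"
  shows "costs (traverse_list f xs) (\<Sum>x\<leftarrow>xs. c x)
           (\<lambda>ys. length ys = length xs \<and> (\<forall>y\<in>set ys. P y))"
  using assms
proof (induction xs)
  case Nil
  show ?case by (simp add: costs_return)
next
  case (Cons x xs)
  have "costs (traverse_list f (x # xs)) (c x + ((\<Sum>x\<leftarrow>xs. c x) + 0))
      (\<lambda>ys. length ys = length (x # xs) \<and> (\<forall>y\<in>set ys. P y))"
    unfolding traverse_list.simps
    by (rule costs_bind[where P = P], use Cons.prems in simp,
        rule costs_bind[OF Cons.IH]) (use Cons.prems in \<open>auto intro!: costs_return\<close>)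
  then show ?case by simp
qed

section \<open>Cost of a truncated product\<close>

lemma costs_sum_counted: "costs (sum_counted xs) (int (length xs)) (\<lambda>_. True)"
proof (induction xs rule: sum_counted.induct)
  case (3 x y xs)
  have "costs (sum_counted (x # y # xs)) (1 + (int (length xs) + 1)) (\<lambda>_. True)"
    unfolding sum_counted.simps
    by (rule costs_bind[OF costs_op(1)]) (use 3 in \<open>simp add: add.commute\<close>)
  then show ?case by simp
qed (auto intro: costs_mono[OF costs_return])

lemma costs_prod_counted: "costs (prod_counted xs) (int (length xs)) (\<lambda>_. True)"
proof (induction xs rule: prod_counted.induct)
  case (3 x y xs)
  have "costs (prod_counted (x # y # xs)) (1 + (int (length xs) + 1)) (\<lambda>_. True)"
    unfolding prod_counted.simps
    by (rule costs_bind[OF costs_op(2)]) (use 3 in \<open>simp add: add.commute\<close>)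
  then show ?case by simp
qed (auto intro: costs_mono[OF costs_return])

text \<open>Each admissible index accounts for one multiplication and at most one addition, whence
  the factor 2.\<close>

lemma costs_conv_coeff:
  "costs (conv_coeff p q m)
     (2 * int (card {i. i < length p \<and> i \<le> m \<and> m < i + length q})) (\<lambda>_. True)"
proof -
  let ?is = "filter (\<lambda>i. i < length p \<and> m - i < length q) [0..<Suc m]"
  have "set ?is = {i. i < length p \<and> i \<le> m \<and> m < i + length q}"
    by (auto simp del: upt_Suc)
  then have len: "length ?is = card {i. i < length p \<and> i \<le> m \<and> m < i + length q}"
    by (metis distinct_card distinct_filter distinct_upt)
  have "costs (conv_coeff p q m) ((\<Sum>i\<leftarrow>?is. 1) + int (length ?is)) (\<lambda>_. True)"
    unfolding conv_coeff_def
    by (rule costs_bind[OF costs_traverse_list[OF costs_op(2)]])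
      (metis costs_sum_counted)
  then show ?thesis
    by (simp add: sum_list_triv len del: upt_Suc filter.simps)
qed

text \<open>A pair of positions \<open>(i, j)\<close> contributes only to the coefficient
  \<open>m = i + j\<close>, so the triangular index set embeds into the rectangle, whatever
  \<open>N\<close> is.\<close>

lemma sum_card_convolution_le:
  "(\<Sum>m<N. card {i. i < a \<and> i \<le> m \<and> m < i + b}) \<le> a * b"
proof -
  have "(\<Sum>m<N. card {i. i < a \<and> i \<le> m \<and> m < i + b})
      = card (SIGMA m:{..<N}. {i. i < a \<and> i \<le> m \<and> m < i + b})"
    by (subst card_SigmaI) auto
  also have "\<dots> \<le> card ({..<a} \<times> {..<b})"
    by (rule card_inj_on_le[where f = "\<lambda>(m, i). (i, m - i)"])
      (auto simp: inj_on_def)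
  finally show ?thesis by simp
qed

lemma costs_trunc_mult:
  "costs (trunc_mult k p q) (2 * int (length p * length q))
     (\<lambda>r. length r = min (Suc k) (length p + length q - 1))"
proof -
  let ?N = "min (Suc k) (length p + length q - 1)"
  let ?c = "\<lambda>m. card {i. i < length p \<and> i \<le> m \<and> m < i + length q}"
  have "(\<Sum>m\<leftarrow>[0..<?N]. 2 * int (?c m)) = 2 * int (\<Sum>m<?N. ?c m)"
    by (simp add: interv_sum_list_conv_sum_set_nat sum_distrib_left atLeast0LessThan)
  also have "\<dots> \<le> 2 * int (length p * length q)"
    using sum_card_convolution_le[where N = ?N and a = "length p" and b = "length q"]
    by linarith
  finally show ?thesis
    unfolding trunc_mult_def
    by (rule costs_mono[OF costs_traverse_list[OF costs_conv_coeff]]) auto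
qed

section \<open>The potential and its superadditivity\<close>

definition potential :: "nat \<Rightarrow> nat \<Rightarrow> int" where
  "potential k t = (int (min k t))\<^sup>2 + 4 * int k * (int t - int (min k t))"

lemma potential_nonneg: "0 \<le> potential k t"
  by (simp add: potential_def)

lemma potential_le: "potential k t \<le> 4 * int k * int t"
proof -
  have "int (min k t) * int (min k t) \<le> int k * int (min k t)"
    by (intro mult_right_mono) auto
  also have "\<dots> \<le> 4 * int k * int (min k t)" by simp
  finally show ?thesis
    by (simp add: potential_def power2_eq_square algebra_simps)
qed

lemma potential_add:
  "potential k a + potential k b + 2 * int (min k a * min k b) \<le> potential k (a + b)"
proof -
  consider "k \<le> a" "k \<le> b" | "k \<le> a" "b \<le> k" | "a \<le> k" "k \<le> b"
    | "a \<le> k" "b \<le> k" "k \<le> a + b" | "a + b \<le> k" by linarith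
  then show ?thesis
  proof cases
    case 1
    then show ?thesis by (simp add: potential_def algebra_simps power2_eq_square)
  next
    case 2
    \<comment> \<open>With \<open>potential k a\<close> cancelled, the claim reads
      \<open>b * b + 2 * k * b \<le> 4 * k * b\<close>.\<close>
    then have "int b * int b \<le> (2 * int k) * int b" by (intro mult_right_mono) auto
    then show ?thesis using 2
      by (simp add: potential_def algebra_simps power2_eq_square)
  next
    case 3
    then have "int a * int a \<le> (2 * int k) * int a" by (intro mult_right_mono) auto
    then show ?thesis using 3
      by (simp add: potential_def algebra_simps power2_eq_square)
  next
    case 4
    \<comment> \<open>For \<open>s = a + b\<close>, the product \<open>(s - k) * (3 * k - s)\<close>
      is exactly the gap \<open>k * k + 4 * k * (s - k) - s * s\<close>; here
      \<open>k \<le> s \<le> 2 * k\<close>.\<close>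
    then have "0 \<le> (int a + int b - int k) * (3 * int k - (int a + int b))"
      by (intro mult_nonneg_nonneg) auto
    with 4 show ?thesis
      by (simp add: potential_def algebra_simps power2_eq_square)
  next
    case 5
    \<comment> \<open>Without truncation the potential is a square, and equality holds by the
      binomial formula.\<close>
    then show ?thesis by (simp add: potential_def algebra_simps power2_eq_square)
  qed
qed

section \<open>Rounds of merging\<close>

text \<open>The effect of \<open>merge_pairs\<close> on untruncated degrees, which add up under
  multiplication.\<close>

fun pair_sums :: "nat list \<Rightarrow> nat list" where
  "pair_sums (a # b # ts) = (a + b) # pair_sums ts"
| "pair_sums ts = ts"

lemma sum_list_pair_sums: "sum_list (pair_sums ts) = sum_list ts"
  by (induction ts rule: pair_sums.induct) auto

lemma pair_sums_pos: "\<forall>t\<in>set ts. 0 < t \<Longrightarrow> \<forall>t\<in>set (pair_sums ts). 0 < t"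
  by (induction ts rule: pair_sums.induct) auto

lemma length_pair_sums: "length (pair_sums ts) = (length ts + 1) div 2"
  by (induction ts rule: pair_sums.induct) auto

text \<open>The list \<open>ts\<close> records the degrees that the polynomials would have without truncation.\<close>

definition truncated_lengths :: "nat \<Rightarrow> nat list \<Rightarrow> real list list \<Rightarrow> bool" where
  "truncated_lengths k ts ps \<longleftrightarrow> map length ps = map (\<lambda>t. Suc (min k t)) ts"

text \<open>Each pair pays for its own product; an unpaired last polynomial cancels in the
  difference of the two sums.\<close>

lemma costs_merge_pairs:
  assumes "1 \<le> k" and "\<forall>t\<in>set ts. 0 < t" and "truncated_lengths k ts ps"
  shows "costs (merge_pairs k ps)
     (4 * (\<Sum>t\<leftarrow>pair_sums ts. potential k t) - 4 * (\<Sum>t\<leftarrow>ts. potential k t))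
     (truncated_lengths k (pair_sums ts))"
  using assms
proof (induction ts arbitrary: ps rule: pair_sums.induct)
  case (1 a b ts)
  from "1.prems"(3) obtain p q ps' where ps: "ps = p # q # ps'"
    and p: "length p = Suc (min k a)" and q: "length q = Suc (min k b)"
    and ps': "truncated_lengths k ts ps'"
    by (auto simp: truncated_lengths_def map_eq_Cons_conv)
  let ?c = "4 * potential k (a + b) - 4 * potential k a - 4 * potential k b"
  let ?d = "4 * (\<Sum>t\<leftarrow>pair_sums ts. potential k t) - 4 * (\<Sum>t\<leftarrow>ts. potential k t)"
  \<comment> \<open>Both minima are at least 1, so adding 1 at most doubles them.\<close>
  have "Suc (min k a) * Suc (min k b) \<le> (2 * min k a) * (2 * min k b)"
    using "1.prems"(1,2) by (intro mult_le_mono) auto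
  then have "2 * int (length p * length q) \<le> 8 * int (min k a * min k b)"
    unfolding p q by linarith
  also have "\<dots> \<le> ?c"
    using potential_add[of k a b] by linarith
  finally have mult: "costs (trunc_mult k p q) ?c (\<lambda>r. length r = Suc (min k (a + b)))"
    by (rule costs_mono[OF costs_trunc_mult]) (auto simp: p q)
  have "costs (merge_pairs k ps) (?c + (?d + 0)) (truncated_lengths k (pair_sums (a # b # ts)))"
    unfolding ps merge_pairs.simps
    using "1.prems"
    by (intro costs_bind[OF mult] costs_bind[OF "1.IH"] costs_return)
      (auto simp: truncated_lengths_def intro: ps'[unfolded truncated_lengths_def])
  then show ?case by (simp add: algebra_simps)
next
  case "2_1"
  then show ?case by (simp add: truncated_lengths_def costs_return)
next
  case ("2_2" t)
  then show ?case by (auto simp: truncated_lengths_def map_eq_Cons_conv intro!: costs_return)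
qed

text \<open>The bounds of successive rounds telescope, and the total degree is invariant, so only
  the first and last potentials remain.\<close>

lemma costs_merge_all:
  assumes "1 \<le> k" and "\<forall>t\<in>set ts. 0 < t" and "truncated_lengths k ts ps" and "ts \<noteq> []"
  shows "costs (merge_all k ps)
     (4 * potential k (sum_list ts) - 4 * (\<Sum>t\<leftarrow>ts. potential k t))
     (truncated_lengths k [sum_list ts])"
  using assms
proof (induction "length ts" arbitrary: ts ps rule: less_induct)
  case less
  have len: "length ps = length ts"
    using less.prems(3) by (metis length_map truncated_lengths_def)
  show ?case
  proof (cases "length ts > 1")
    case True
    let ?us = "pair_sums ts"
    have us: "length ?us < length ts" "\<forall>t\<in>set ?us. 0 < t" "?us \<noteq> []"
      using True less.prems(2) length_pair_sums[of ts] by (auto simp: pair_sums_pos)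
    have "costs (merge_all k ps)
       ((4 * (\<Sum>t\<leftarrow>?us. potential k t) - 4 * (\<Sum>t\<leftarrow>ts. potential k t)) +
        (4 * potential k (sum_list ?us) - 4 * (\<Sum>t\<leftarrow>?us. potential k t)))
       (truncated_lengths k [sum_list ?us])"
      unfolding merge_all.simps[of k ps] using True len
      by (simp only: if_True, intro costs_bind[OF costs_merge_pairs] less.hyps us less.prems)
    then show ?thesis by (simp add: sum_list_pair_sums)
  next
    case False
    with less.prems(4) obtain t where ts: "ts = [t]"
      by (cases ts) auto
    show ?thesis
      using len less.prems(3) by (auto simp: ts merge_all.simps[of k ps] intro: costs_return)
  qed
qed

section \<open>The whole algorithm\<close>

lemma costs_forward_alg:
  assumes "1 \<le> k" and "es \<noteq> []"
  shows "costs (forward_alg k es) (20 * int k * int (length es)) (\<lambda>_. True)"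
proof -
  let ?n = "length es"
  let ?ts = "replicate ?n (1::nat)"
  let ?m = "int (Suc (min k ?n))"
  have init: "costs (do { c \<leftarrow> op_divide 1 e; State_Monad.return [c, 1] }) (1 + 0)
      (\<lambda>p. length p = 2)" for e
    by (rule costs_bind[OF costs_op(3)]) (simp add: costs_return)
  have lens: "truncated_lengths k ?ts ps" if "length ps = ?n \<and> (\<forall>p\<in>set ps. length p = 2)" for ps
    using that assms(1) by (auto simp: truncated_lengths_def intro!: nth_equalityI)
  have merge: "costs (merge_all k ps) (16 * int k * int ?n) (\<lambda>rs. length (hd rs) = Suc (min k ?n))"
    if "length ps = ?n \<and> (\<forall>p\<in>set ps. length p = 2)" for ps
  proof (rule costs_mono[OF costs_merge_all[OF assms(1) _ lens[OF that]]])
    \<comment> \<open>The initial potential is simply dropped; the final one is at most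
      \<open>4 * k * n\<close>, which gives the constant 16.\<close>
    have "0 \<le> (\<Sum>t\<leftarrow>?ts. potential k t)"
      by (intro sum_list_nonneg) (auto simp: potential_nonneg)
    then show "4 * potential k (sum_list ?ts) - 4 * (\<Sum>t\<leftarrow>?ts. potential k t)
        \<le> 16 * int k * int ?n"
      using potential_le[of k ?n] by (simp add: sum_list_replicate)
  qed (use assms(2) in \<open>auto simp: truncated_lengths_def sum_list_replicate map_eq_Cons_conv\<close>)
  have scale: "costs (traverse_list (op_mult d) r) ?m (\<lambda>_. True)"
    if "length r = Suc (min k ?n)" for d r
    by (rule costs_mono[OF costs_traverse_list[OF costs_op(2)]]) (use that in \<open>auto simp: sum_list_triv\<close>)
  have "costs (forward_alg k es)
      ((\<Sum>e\<leftarrow>es. 1 + 0) + (16 * int k * int ?n + (int ?n + ?m))) (\<lambda>_. True)"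
    unfolding forward_alg_def
    by (intro costs_bind[OF costs_traverse_list[OF init]] costs_bind[OF merge]
        costs_bind[OF costs_prod_counted] scale)
  \<comment> \<open>Initialization, the product of the inputs and the final scaling cost at most
    \<open>n + n + (n + 1) \<le> 4 * k * n\<close>, which raises 16 to 20.\<close>
  moreover have "int ?n \<le> int k * int ?n" "1 \<le> int ?n"
    using assms by (auto simp: Suc_le_eq)
  moreover have "?m \<le> 1 + int ?n" by simp
  ultimately show ?thesis
    by (elim costs_mono) (auto simp: sum_list_triv)
qed

theorem proposition5:
  shows "\<exists>C :: real. \<forall>(n :: nat) (k :: nat) (es :: real list).
    n \<ge> 1 \<longrightarrow> k \<ge> 1 \<longrightarrow> length es = n \<longrightarrow> (\<forall>e \<in> set es. e > 0) \<longrightarrow>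
    real (arith_ops (forward_alg k es)) \<le> C * real k * real n"
proof (intro exI[of _ 20] allI impI)
  fix n k :: nat and es :: "real list"
  assume "n \<ge> 1" "k \<ge> 1" "length es = n"
  then have "int (arith_ops (forward_alg k es)) \<le> 20 * int k * int n"
    using arith_ops_le[OF costs_forward_alg[of k es]] by fastforce
  then have "real_of_int (int (arith_ops (forward_alg k es))) \<le> real_of_int (20 * int k * int n)"
    by (simp only: of_int_le_iff)
  then show "real (arith_ops (forward_alg k es)) \<le> 20 * real k * real n"
    by simp
qed

end
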